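(* Let $g\geq2$ be an integer and let $\mathcal{D}=\{d_1,\dots,d_t\}\subseteq\{0,\dots,g-1\}$ be a set of $t\ge2$ distinct digits, where $d_1$ is the smallest digit. Let $a,a'\in\mathbb{N}$ satisfy $\gcd(g,a)=\gcd(a,a')=1$ and put $\delta=\gcd(aa',d_2-d_1,\dots,d_t-d_1)$. For $(b,b')\in\mathbb{Z}/a\mathbb{Z}\times\mathbb{Z}/a'\mathbb{Z}$ consider the limit $$L(b,b')=\lim_{N\to\infty}\frac{|\{n\in\mathcal{C}_{g,\mathcal{D}}: n\equiv b\pmod a,\ S_g(n)\equiv b'\pmod{a'}\}\cap[0,N)|}{|\mathcal{C}_{g,\mathcal{D}}\cap[0,N)|}.$$ Then: (1) $\mathcal{C}_{g,\mathcal{D}}$ is jointly uniformly distributed mod $(a,a')$ if and only if $\delta=1$. (2) Let $\delta_a=\gcd(\delta,a)$ and $\delta_{a'}=\gcd(\delta,a')$. If $d_1\equiv0\pmod{\delta_a}$ and $d_1\equiv0\pmod{\delta_{a'}}$, then $L(b,b')=\frac{\delta}{aa'}$ for every $(b,b')$ in the subgroup $\langle\delta_a\rangle\times\langle\delta_{a'}\rangle\subseteq\mathbb{Z}/a\mathbb{Z}\times\mathbb{Z}/a'\mathbb{Z}$, while if $(b,b')\notin\langle\delta_a\rangle\times\langle\delta_{a'}\rangle$, then $\{n\in\mathcal{C}_{g,\mathcal{D}}: n\equiv b\pmod a,\ S_g(n)\equiv b'\pmod{a'}\}=\emptyset$. (3) In any other case, for every $(b,b')\in\mathbb{Z}/a\mathbb{Z}\times\mathbb{Z}/a'\mathbb{Z}$,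 the limit $L(b,b')$ either equals zero or does not exist.
   Context: $\mathbb{N}=\{1,2,\dots\}$ and $\mathbb{N}_0=\mathbb{N}\cup\{0\}$. $\mathcal{C}_{g,\mathcal{D}}=\{\sum_{i=0}^m w_ig^i: m\in\mathbb{N}_0,\ w_i\in\mathcal{D}\}$. $S_g(n)$ is the sum of the base-$g$ digits of $n$. A set $A\subseteq\mathbb{N}_0$ is jointly uniformly distributed mod $(a,a')$ if $\lim_{N\to\infty}\frac{|\{n\in A: n\equiv b\pmod a,\ S_g(n)\equiv b'\pmod{a'}\}\cap[0,N)|}{|A\cap[0,N)|}=\frac1{aa'}$ for every $b\in\mathbb{Z}/a\mathbb{Z}$, $b'\in\mathbb{Z}/a'\mathbb{Z}$. $\langle\delta_a\rangle$ denotes the subgroup of $\mathbb{Z}/a\mathbb{Z}$ generated by $\delta_a$, and similarly $\langle\delta_{a'}\rangle\subseteq\mathbb{Z}/a'\mathbb{Z}$. *)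

theory Defs
  imports
    Complex_Main
    "HOL-Number_Theory.Cong"
    "HOL-Algebra.Elementary_Groups"
    "HOL-Algebra.Generated_Groups"
begin

definition digit_restricted :: "nat \<Rightarrow> nat set \<Rightarrow> nat set" where
  "digit_restricted g D = {(\<Sum>i\<le>m. w i * g ^ i) | (m :: nat) w. \<forall>i\<le>m. w i \<in> D}"

text \<open>The digit of \<open>n\<close> at position \<open>i\<close> is \<open>n div g ^ i mod g\<close>; for \<open>g \<ge> 2\<close> the positions with
  \<open>g ^ i \<le> n\<close> are finitely many and carry all nonzero digits.\<close>
definition digit_sum :: "nat \<Rightarrow> nat \<Rightarrow> nat" where
  "digit_sum g n = (\<Sum>i | g ^ i \<le> n. n div g ^ i mod g)"

text \<open>The group \<open>\<int>/a\<int>\<close> is \<^term>\<open>integer_mod_group a\<close>, whose carrier for \<open>a > 0\<close> consists of the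
  integers \<open>0, \<dots>, a - 1\<close>; its elements are used below as residues \<open>b\<close>, \<open>b'\<close>.\<close>
definition joint_class :: "nat \<Rightarrow> nat set \<Rightarrow> nat \<Rightarrow> nat \<Rightarrow> int \<Rightarrow> int \<Rightarrow> nat set" where
  "joint_class g A a a' b b' =
     {n \<in> A. [int n = b] (mod int a) \<and> [int (digit_sum g n) = b'] (mod int a')}"

definition joint_ratio :: "nat \<Rightarrow> nat set \<Rightarrow> nat \<Rightarrow> nat \<Rightarrow> int \<Rightarrow> int \<Rightarrow> nat \<Rightarrow> real" where
  "joint_ratio g A a a' b b' N =
     real (card (joint_class g A a a' b b' \<inter> {0..<N})) / real (card (A \<inter> {0..<N}))"

definition jointly_uniformly_distributed :: "nat \<Rightarrow> nat set \<Rightarrow> nat \<Rightarrow> nat \<Rightarrow> bool" where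
  "jointly_uniformly_distributed g A a a' \<longleftrightarrow>
     (\<forall>b \<in> carrier (integer_mod_group a). \<forall>b' \<in> carrier (integer_mod_group a').
        joint_ratio g A a a' b b' \<longlonglongrightarrow> 1 / (real a * real a'))"

text \<open>The reduction \<open>mod a\<close> is needed because \<open>d = a\<close> is allowed and stands for the class of \<open>0\<close>.\<close>
definition residue_subgroup :: "nat \<Rightarrow> nat \<Rightarrow> int set" where
  "residue_subgroup a d = generate (integer_mod_group a) {int d mod int a}"

end

theory Submission
  imports Defs "HOL-Library.Real_Mod"
begin

text \<open>Let \<open>e(x) = exp(2 \<pi> i x)\<close>, let \<open>F x y N\<close> be the sum of \<open>e(x n + y S\<^sub>g(n))\<close> over the \<open>n < N\<close>
  with digits in \<open>D\<close>, and let \<open>A N\<close> be the number of such \<open>n\<close>. Splitting off the last digit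
  \<open>n = g m + d\<close> gives \<open>F x y N = (\<Sum>d\<in>D. e((x + y) d)) * F (g x) y (N div g) + O(g)\<close> and
  \<open>A N \<ge> card D * A (N div g)\<close>. For a character of \<open>\<int>/a\<int> \<times> \<int>/a'\<int>\<close> that is nontrivial on
  \<open>\<langle>\<delta>\<^sub>a\<rangle> \<times> \<langle>\<delta>\<^sub>a\<^sub>'\<rangle>\<close> the sum over \<open>D\<close> is at most \<open>\<rho> * card D\<close> in modulus with a uniform \<open>\<rho> < 1\<close>,
  and \<open>x \<mapsto> g x\<close> preserves such characters, so iterating yields \<open>F/A \<longlonglongrightarrow> 0\<close>. Fourier inversion
  then gives the limits in (2).

  For (3), all digits are nonzero, so the number of digits \<open>k\<close> of \<open>n\<close> is read off its size, and
  \<open>n \<equiv> d\<^sub>1 (1 + g + \<dots> + g\<^sup>k\<^sup>-\<^sup>1)\<close> mod \<open>\<delta>\<^sub>a\<close>, \<open>S\<^sub>g(n) \<equiv> k d\<^sub>1\<close> mod \<open>\<delta>\<^sub>a\<^sub>'\<close>. Two consecutive values of \<open>k\<close>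
  cannot both be compatible with \<open>(b, b')\<close>, so the ratio at least halves from \<open>g\<^sup>k\<^sup>-\<^sup>1\<close> to \<open>g\<^sup>k\<close>
  infinitely often, which forces any limit to be zero.\<close>

section \<open>Additive characters\<close>

definition unit_exp :: "real \<Rightarrow> complex" where
  "unit_exp x = cis (2 * pi * x)"

lemma unit_exp_add: "unit_exp (x + y) = unit_exp x * unit_exp y"
  by (simp add: unit_exp_def cis_mult distrib_left)

lemma norm_unit_exp [simp]: "norm (unit_exp x) = 1"
  by (simp add: unit_exp_def)

lemma unit_exp_nonzero [simp]: "unit_exp x \<noteq> 0"
  by (simp add: unit_exp_def)

lemma unit_exp_power: "unit_exp x ^ n = unit_exp (n * x)"
  by (simp add: unit_exp_def DeMoivre mult_ac)

lemma unit_exp_eq_1_iff: "unit_exp x = 1 \<longleftrightarrow> x \<in> \<int>"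
  by (auto simp: unit_exp_def cis_eq_1_iff Ints_def)

lemma of_int_divide_in_Ints_iff:
  assumes "q > 0"
  shows "real_of_int k / real q \<in> \<int> \<longleftrightarrow> int q dvd k"
proof
  assume "real_of_int k / real q \<in> \<int>"
  then obtain m where "real_of_int k / real q = of_int m"
    by (auto elim: Ints_cases)
  then have "real_of_int k = of_int (m * int q)"
    using assms by (simp add: field_simps)
  then have "k = m * int q"
    by linarith
  then show "int q dvd k"
    by simp
next
  assume "int q dvd k"
  then show "real_of_int k / real q \<in> \<int>"
    using assms by (auto elim!: dvdE)
qed

lemma unit_exp_divide_eq_iff:
  fixes m n q :: nat
  assumes "q > 0"
  shows "unit_exp (real m / real q) = unit_exp (real n / real q) \<longleftrightarrow> [m = n] (mod q)"
proof -
  have "unit_exp (real m / real q)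
      = unit_exp (real n / real q) * unit_exp (real_of_int (int m - int n) / real q)"
    by (simp flip: unit_exp_add add: diff_divide_distrib)
  then have "unit_exp (real m / real q) = unit_exp (real n / real q)
      \<longleftrightarrow> unit_exp (real_of_int (int m - int n) / real q) = 1"
    by simp
  also have "\<dots> \<longleftrightarrow> [int m = int n] (mod int q)"
    using assms by (simp only: unit_exp_eq_1_iff of_int_divide_in_Ints_iff cong_iff_dvd_diff)
  finally show ?thesis
    by (simp add: cong_int_iff)
qed

text \<open>Orthogonality of characters: a geometric series in a \<open>q\<close>-th root of unity,
  which vanishes unless the root is 1.\<close>

lemma sum_unit_exp:
  fixes k :: int and q :: nat
  assumes "q > 0"
  shows "(\<Sum>h<q. unit_exp (real h * (real_of_int k / real q))) = (if int q dvd k then of_nat q else 0)"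
proof -
  define z where "z = unit_exp (real_of_int k / real q)"
  have "z ^ q = 1"
    using assms by (simp add: z_def unit_exp_power unit_exp_eq_1_iff)
  moreover have "z = 1 \<longleftrightarrow> int q dvd k"
    using assms by (simp add: z_def unit_exp_eq_1_iff of_int_divide_in_Ints_iff)
  moreover have "(\<Sum>h<q. unit_exp (real h * (real_of_int k / real q))) = (\<Sum>h<q. z ^ h)"
    by (simp only: z_def unit_exp_power)
  ultimately show ?thesis
    by (simp only: sum_gp_strict) simp
qed

text \<open>By the parallelogram law the two squared norms add up to 4, and \<open>z - w\<close>
  takes a positive share of it.\<close>

lemma norm_add_less_2:
  fixes z w :: complex
  assumes "norm z = 1" "norm w = 1" "z \<noteq> w"
  shows "norm (z + w) < 2"
proof -
  have "(norm (z + w))\<^sup>2 + (norm (z - w))\<^sup>2 = 2 * (norm z)\<^sup>2 + 2 * (norm w)\<^sup>2"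
    unfolding cmod_power2 by (simp add: power2_eq_square algebra_simps)
  then have "(norm (z + w))\<^sup>2 + (norm (z - w))\<^sup>2 = 2\<^sup>2"
    using assms by simp
  moreover have "(norm (z - w))\<^sup>2 > 0"
    using assms by simp
  ultimately have "(norm (z + w))\<^sup>2 < 2\<^sup>2"
    by linarith
  then show ?thesis
    by (rule power_less_imp_less_base) simp
qed

text \<open>One pair of distinct summands already causes a strict loss; the triangle inequality
  handles the rest.\<close>

lemma norm_sum_less_card:
  fixes f :: "'a \<Rightarrow> complex"
  assumes "finite A" "\<And>x. x \<in> A \<Longrightarrow> norm (f x) = 1"
    and xy: "x \<in> A" "y \<in> A" "f x \<noteq> f y"
  shows "norm (\<Sum>x\<in>A. f x) < card A"
proof -
  have ne: "x \<noteq> y"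
    using xy by auto
  have "(\<Sum>x\<in>A. f x) = (\<Sum>x\<in>A - {x, y}. f x) + (\<Sum>x\<in>{x, y}. f x)"
    using assms by (intro sum.subset_diff) auto
  then have "norm (\<Sum>x\<in>A. f x) \<le> norm (\<Sum>x\<in>A - {x, y}. f x) + norm (f x + f y)"
    using ne by (simp add: norm_triangle_ineq)
  also have "norm (\<Sum>x\<in>A - {x, y}. f x) \<le> (\<Sum>x\<in>A - {x, y}. 1)"
    using assms by (intro sum_norm_le) auto
  also have "\<dots> = real (card A) - 2"
  proof -
    have "card {x, y} \<le> card A"
      using assms by (intro card_mono) auto
    then show ?thesis
      using assms ne by (simp add: card_Diff_subset of_nat_diff)
  qed
  also have "norm (f x + f y) < 2"
    using assms by (intro norm_add_less_2) auto
  finally show ?thesis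
    by simp
qed

text \<open>The sum depends only on \<open>u mod q\<close>, so only finitely many norms occur and
  their maximum stays below 1. A single \<rho> for all \<open>u\<close> is required because the
  character changes with every digit that is split off.\<close>

lemma character_sum_contraction:
  fixes D :: "nat set" and q :: nat
  assumes "q > 0" "finite D"
  obtains \<rho> :: real where "0 \<le> \<rho>" "\<rho> < 1"
    "\<And>u. \<exists>d\<in>D. \<exists>e\<in>D. \<not> [u * d = u * e] (mod q) \<Longrightarrow>
       norm (\<Sum>d\<in>D. unit_exp (real (u * d) / real q)) \<le> \<rho> * card D"
proof -
  define f where "f u = norm (\<Sum>d\<in>D. unit_exp (real (u * d) / real q)) / card D" for u
  define U where "U = {u. u < q \<and> (\<exists>d\<in>D. \<exists>e\<in>D. \<not> [u * d = u * e] (mod q))}"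
  \<comment> \<open>Inserting 0 makes the maximum meaningful when \<open>U\<close> is empty and
    ensures \<rho> \<ge> 0.\<close>
  define \<rho> where "\<rho> = Max (insert 0 (f ` U))"
  have fin: "finite (insert 0 (f ` U))"
    by (auto simp: U_def)
  have nonneg: "0 \<le> \<rho>"
    unfolding \<rho>_def using fin by (intro Max_ge) auto
  have "f u < 1" if u: "u \<in> U" for u
  proof -
    obtain d e where "d \<in> D" "e \<in> D" "\<not> [u * d = u * e] (mod q)"
      using u by (auto simp: U_def)
    then have "norm (\<Sum>d\<in>D. unit_exp (real (u * d) / real q)) < card D"
      using assms unit_exp_divide_eq_iff[OF assms(1)] by (intro norm_sum_less_card[of D _ d e]) (simp_all del: of_nat_mult)
    then show ?thesis
      by (simp add: f_def divide_less_eq)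
  qed
  then have less: "\<rho> < 1"
    unfolding \<rho>_def using fin by (subst Max_less_iff) auto
  have bound: "norm (\<Sum>d\<in>D. unit_exp (real (u * d) / real q)) \<le> \<rho> * card D"
    if "\<exists>d\<in>D. \<exists>e\<in>D. \<not> [u * d = u * e] (mod q)" for u
  proof -
    have red: "[u mod q * d = u * d] (mod q)" for d
      by (simp add: cong_def mod_mult_left_eq)
    have eq: "(\<Sum>d\<in>D. unit_exp (real (u * d) / real q))
        = (\<Sum>d\<in>D. unit_exp (real (u mod q * d) / real q))"
      by (intro sum.cong refl, subst unit_exp_divide_eq_iff[OF assms(1)]) (metis red cong_sym)
    have "u mod q \<in> U"
      using that red assms(1) unfolding U_def by (simp add: cong_def mod_mult_left_eq)
    then have "f (u mod q) \<le> \<rho>"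
      unfolding \<rho>_def using fin by (intro Max_ge) auto
    moreover have "card D > 0"
      using that assms by (auto simp: card_gt_0_iff)
    ultimately show ?thesis
      by (simp add: f_def eq divide_le_eq del: of_nat_mult)
  qed
  show ?thesis
    by (rule that[OF nonneg less bound])
qed

section \<open>Numbers with restricted digits\<close>

text \<open>Recursion on the least significant digit. The digits themselves form the base case:
  every expansion has at least one digit, so 0 is available as a start only if it is a
  digit.\<close>

lemma digit_restricted_iff:
  "n \<in> digit_restricted g D \<longleftrightarrow> n \<in> D \<or> (\<exists>m\<in>digit_restricted g D. \<exists>d\<in>D. n = g * m + d)"
proof
  assume "n \<in> digit_restricted g D"
  then obtain m w where n: "n = (\<Sum>i\<le>m. w i * g ^ i)" and w: "\<forall>i\<le>m. w i \<in> D"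
    by (auto simp: digit_restricted_def)
  show "n \<in> D \<or> (\<exists>m\<in>digit_restricted g D. \<exists>d\<in>D. n = g * m + d)"
  proof (cases m)
    case 0
    then show ?thesis
      using n w by simp
  next
    case (Suc k)
    have "n = g * (\<Sum>i\<le>k. w (Suc i) * g ^ i) + w 0"
      unfolding n Suc sum.atMost_Suc_shift by (simp add: sum_distrib_left mult_ac)
    moreover have "(\<Sum>i\<le>k. w (Suc i) * g ^ i) \<in> digit_restricted g D"
      unfolding digit_restricted_def using w Suc by (auto intro!: exI[of _ k] exI[of _ "\<lambda>i. w (Suc i)"])
    ultimately show ?thesis
      using w by auto
  qed
next
  assume "n \<in> D \<or> (\<exists>m\<in>digit_restricted g D. \<exists>d\<in>D. n = g * m + d)"
  then show "n \<in> digit_restricted g D"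
  proof
    assume "n \<in> D"
    then show ?thesis
      unfolding digit_restricted_def by (auto intro!: exI[of _ 0] exI[of _ "\<lambda>_. n"])
  next
    assume "\<exists>m\<in>digit_restricted g D. \<exists>d\<in>D. n = g * m + d"
    then obtain k w d where n: "n = g * (\<Sum>i\<le>k. w i * g ^ i) + d"
      and w: "\<forall>i\<le>k. w i \<in> D" and d: "d \<in> D"
      by (auto simp: digit_restricted_def)
    \<comment> \<open>\<open>case_nat\<close> puts \<open>d\<close> at position 0 and moves the
      digits \<open>w\<close> up by one.\<close>
    define w' where "w' = case_nat d w"
    have "n = (\<Sum>i\<le>Suc k. w' i * g ^ i)"
      unfolding n sum.atMost_Suc_shift w'_def by (simp add: sum_distrib_left mult_ac)
    moreover have "\<forall>i\<le>Suc k. w' i \<in> D"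
      using w d by (auto simp: w'_def split: nat.splits)
    ultimately show ?thesis
      unfolding digit_restricted_def by blast
  qed
qed

text \<open>The positions counted for \<open>g * m + d\<close>, apart from 0, are the successors of
  those counted for \<open>m\<close>, and dividing by \<open>g\<close> matches the digits.\<close>

lemma digit_sum_snoc:
  assumes "g \<ge> 2" "d < g"
  shows "digit_sum g (g * m + d) = digit_sum g m + d"
proof -
  have fin: "finite {i. g ^ i \<le> n}" for n
  proof (rule finite_subset)
    show "{i. g ^ i \<le> n} \<subseteq> {..n}"
      using less_exp assms(1) by (metis (mono_tags, lifting) atMost_iff le_trans less_imp_le mem_Collect_eq
          power_mono zero_le subsetI)
  qed simp
  have pow: "g ^ Suc i \<le> g * m + d \<longleftrightarrow> g ^ i \<le> m" for i
  proof -
    have "g * g ^ i \<le> g * m + d \<longleftrightarrow> g ^ i \<le> (g * m + d) div g"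
      using assms by (subst less_eq_div_iff_mult_less_eq) (auto simp: mult.commute)
    then show ?thesis
      using assms by simp
  qed
  have set: "{i. g ^ i \<le> g * m + d} - {0} = Suc ` {i. g ^ i \<le> m}" (is "?A - _ = _")
  proof safe
    fix i assume "g ^ i \<le> g * m + d" "i \<notin> Suc ` {i. g ^ i \<le> m}"
    then show "i = 0"
      using pow by (cases i) auto
  qed (use pow in auto)
  \<comment> \<open>Position 0 is counted only if \<open>g * m + d\<close> is positive; otherwise
    \<open>d = 0\<close>, and its absence changes nothing.\<close>
  have "digit_sum g (g * m + d) = d + (\<Sum>i\<in>?A - {0}. (g * m + d) div g ^ i mod g)"
  proof (cases "0 \<in> ?A")
    case True
    then show ?thesis
      unfolding digit_sum_def using assms by (subst sum.remove[OF fin True]) simp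
  next
    case False
    then have "d = 0"
      by simp
    then show ?thesis
      using False by (simp add: digit_sum_def)
  qed
  also have "(\<Sum>i\<in>?A - {0}. (g * m + d) div g ^ i mod g) = digit_sum g m"
    unfolding set using assms by (simp add: sum.reindex digit_sum_def div_mult2_eq)
  finally show ?thesis
    by simp
qed

lemma digit_sum_0 [simp]: "g \<ge> 2 \<Longrightarrow> digit_sum g 0 = 0"
  by (simp add: digit_sum_def)

lemma digit_sum_digit: "g \<ge> 2 \<Longrightarrow> d < g \<Longrightarrow> digit_sum g d = d"
  using digit_sum_snoc[of g d 0] by simp

section \<open>Decay of character sums\<close>

locale digit_set =
  fixes g :: nat and D :: "nat set"
  assumes base: "2 \<le> g" and digits: "D \<subseteq> {..<g}" and two_digits: "2 \<le> card D"
begin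

abbreviation C :: "nat set" where
  "C \<equiv> digit_restricted g D"

definition char_sum :: "real \<Rightarrow> real \<Rightarrow> nat \<Rightarrow> complex" where
  "char_sum x y N = (\<Sum>n\<in>C \<inter> {0..<N}. unit_exp (x * real n + y * real (digit_sum g n)))"

lemma finite_digits [simp]: "finite D"
  using digits finite_subset by blast

text \<open>Since \<open>g \<ge> 2\<close>, removing the last digit decreases the number unless the
  quotient is 0, and then the number is itself a digit.\<close>

lemma digit_restricted_induct [consumes 1, case_names digit snoc]:
  assumes "n \<in> C"
    and digit: "\<And>d. d \<in> D \<Longrightarrow> P d"
    and snoc: "\<And>m d. m \<in> C \<Longrightarrow> d \<in> D \<Longrightarrow> P m \<Longrightarrow> P (g * m + d)"
  shows "P n"
  using assms(1)
proof (induction n rule: less_induct)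
  case (less n)
  show ?case
  proof (cases "n \<in> D")
    case False
    with less.prems obtain m d where md: "m \<in> C" "d \<in> D" "n = g * m + d"
      using digit_restricted_iff by metis
    have "2 * m \<le> g * m"
      using base by (rule mult_le_mono1)
    then have "m < n" if "m > 0"
      using md(3) that by linarith
    moreover have "n = d" if "m = 0"
      using md(3) that by simp
    ultimately have "m < n \<or> m = 0 \<and> n = d"
      by blast
    then show ?thesis
      using less.IH[of m] md snoc digit by metis
  qed (use digit in auto)
qed

text \<open>Both facts rest on the injection \<open>(m, d) \<mapsto> g * m + d\<close> from pairs
  with \<open>m < N div g\<close> into the elements below \<open>N\<close>. The number of elements
  that it misses is bounded independently of \<open>N\<close>.\<close>

lemma card_mult_div: "card D * card (C \<inter> {0..<N div g}) \<le> card (C \<inter> {0..<N})"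
  and char_sum_step: "norm (char_sum x y N :: complex)
    \<le> norm (\<Sum>d\<in>D. unit_exp ((x + y) * real d)) * norm (char_sum (real g * x) y (N div g)) + 2 * g"
proof -
  define M where "M = N div g"
  define f where "f = (\<lambda>(m, d). g * m + d)"
  define P where "P = (C \<inter> {0..<M}) \<times> D"
  have finP: "finite P"
    by (simp add: P_def)
  have gM: "g * M \<le> N" "N < g * M + g"
    unfolding M_def using base dividend_less_times_div[of g N] by (simp_all add: add.commute)
  have inj: "inj_on f P"
  proof (rule inj_onI)
    fix p q assume pq: "p \<in> P" "q \<in> P" "f p = f q"
    obtain m d m' d' where eq: "p = (m, d)" "q = (m', d')"
      by (cases p, cases q)
    have "d < g" "d' < g"
      using pq digits by (auto simp: eq P_def)
    moreover have "g * m + d = g * m' + d'"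
      using pq by (simp add: eq f_def)
    ultimately have "m = m'"
      by (metis add.right_neutral div_less div_mult_self4 mult.commute base not_numeral_le_zero)
    then show "p = q"
      using pq by (simp add: eq f_def)
  qed
  have sub: "f ` P \<subseteq> C \<inter> {0..<N}"
  proof clarify
    fix m d assume "(m, d) \<in> P"
    then have md: "m \<in> C" "m < M" "d \<in> D" "d < g"
      using digits by (auto simp: P_def)
    have "g * m + d < g * Suc m"
      using md by simp
    also have "\<dots> \<le> g * M"
      using md by (intro mult_le_mono2) simp
    finally have "g * m + d < N"
      using gM by simp
    then show "f (m, d) \<in> C \<inter> {0..<N}"
      using md digit_restricted_iff[of "g * m + d" g D] by (auto simp: f_def)
  qed
  have "card (f ` P) = card (C \<inter> {0..<M}) * card D"
    using inj by (simp add: card_image P_def card_cartesian_product)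
  moreover have "card (f ` P) \<le> card (C \<inter> {0..<N})"
    using sub by (intro card_mono) auto
  ultimately show "card D * card (C \<inter> {0..<N div g}) \<le> card (C \<inter> {0..<N})"
    by (simp add: M_def mult.commute)
  define R where "R = C \<inter> {0..<N} - f ` P"
  \<comment> \<open>A missed element is a lone digit or lies in the incomplete last block; any other
    one is \<open>g * m + d\<close> with \<open>m < M\<close>, hence in the image.\<close>
  have "R \<subseteq> D \<union> {g * M..<g * M + g}"
  proof
    fix n assume n: "n \<in> R"
    show "n \<in> D \<union> {g * M..<g * M + g}"
    proof (rule ccontr)
      assume not: "n \<notin> D \<union> {g * M..<g * M + g}"
      then have "n < g * M"
        using n gM by (auto simp: R_def)
      moreover obtain m d where md: "m \<in> C" "d \<in> D" "n = g * m + d"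
        using n not digit_restricted_iff[of n g D] by (auto simp: R_def)
      ultimately have "g * m < g * M"
        by linarith
      then have "(m, d) \<in> P"
        using md by (simp add: P_def)
      then have "n \<in> f ` P"
        using md by (auto simp: f_def intro!: image_eqI[of _ _ "(m, d)"])
      then show False
        using n by (simp add: R_def)
    qed
  qed
  then have "card R \<le> card (D \<union> {g * M..<g * M + g})"
    by (intro card_mono) auto
  also have "\<dots> \<le> card D + g"
    by (rule order_trans[OF card_Un_le]) simp
  also have "card D \<le> g"
    using card_mono[OF _ digits] by simp
  finally have cardR: "card R \<le> 2 * g"
    by simp
  define \<chi> where "\<chi> n = unit_exp (x * real n + y * real (digit_sum g n))" for n
  have "char_sum x y N = sum \<chi> R + sum \<chi> (f ` P)"
    unfolding char_sum_def R_def \<chi>_def using sub by (intro sum.subset_diff) auto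
  also have "sum \<chi> (f ` P) = (\<Sum>p\<in>P. \<chi> (f p))"
    using inj by (simp add: sum.reindex)
  \<comment> \<open>The exponent \<open>x (g m + d) + y (S(m) + d)\<close> separates into
    \<open>(g x) m + y S(m)\<close> and \<open>(x + y) d\<close>, so the sum factors and
    \<open>x\<close> turns into \<open>g x\<close>.\<close>
  also have "\<dots> = (\<Sum>(m, d)\<in>P.
      unit_exp (real g * x * real m + y * real (digit_sum g m)) * unit_exp ((x + y) * real d))"
  proof (intro sum.cong refl, clarify)
    fix m d assume "(m, d) \<in> P"
    then have "digit_sum g (g * m + d) = digit_sum g m + d"
      using digits base by (intro digit_sum_snoc) (auto simp: P_def)
    then show "\<chi> (f (m, d)) = unit_exp (real g * x * real m + y * real (digit_sum g m)) * unit_exp ((x + y) * real d)"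
      unfolding \<chi>_def f_def unit_exp_add[symmetric] by (simp add: algebra_simps)
  qed
  also have "\<dots> = char_sum (real g * x) y M * (\<Sum>d\<in>D. unit_exp ((x + y) * real d))"
    by (simp add: P_def char_sum_def sum_product sum.cartesian_product)
  finally have "norm (char_sum x y N)
      \<le> norm (sum \<chi> R) + norm (char_sum (real g * x) y M) * norm (\<Sum>d\<in>D. unit_exp ((x + y) * real d))"
    by (metis norm_triangle_ineq norm_mult)
  moreover have "norm (sum \<chi> R) \<le> (\<Sum>n\<in>R. 1)"
    by (intro sum_norm_le) (simp add: \<chi>_def)
  ultimately show "norm (char_sum x y N)
    \<le> norm (\<Sum>d\<in>D. unit_exp ((x + y) * real d)) * norm (char_sum (real g * x) y (N div g)) + 2 * g"
    using cardR by (simp add: M_def mult.commute)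
qed

text \<open>Each further digit at least doubles the count; this is what makes bounded error terms
  negligible later.\<close>

lemma card_digit_restricted_power: "2 ^ Suc k \<le> card (C \<inter> {0..<g ^ Suc k})"
proof (induction k)
  case 0
  have "D \<subseteq> C \<inter> {0..<g}"
    using digits digit_restricted_iff[of _ g D] by auto
  then have "card D \<le> card (C \<inter> {0..<g})"
    by (intro card_mono) auto
  then show ?case
    using two_digits by simp
next
  case (Suc k)
  have "2 ^ Suc (Suc k) \<le> card D * card (C \<inter> {0..<g ^ Suc k})"
    using mult_mono[OF two_digits Suc] by simp
  also have "\<dots> \<le> card (C \<inter> {0..<g ^ Suc (Suc k)})"
    using card_mult_div[of "g ^ Suc (Suc k)"] base by simp
  finally show ?case .
qed

lemma filterlim_card_digit_restricted:
  "filterlim (\<lambda>N. real (card (C \<inter> {0..<N}))) at_top sequentially"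
proof (rule filterlim_compose[OF filterlim_real_sequentially])
  show "filterlim (\<lambda>N. card (C \<inter> {0..<N})) at_top sequentially"
    unfolding filterlim_at_top eventually_sequentially
  proof safe
    fix k
    have "k \<le> card (C \<inter> {0..<N})" if "N \<ge> g ^ Suc k" for N
    proof -
      have "k \<le> 2 ^ Suc k"
        using less_exp[of "Suc k"] by linarith
      also have "\<dots> \<le> card (C \<inter> {0..<g ^ Suc k})"
        by (rule card_digit_restricted_power)
      also have "\<dots> \<le> card (C \<inter> {0..<N})"
        using that by (intro card_mono) auto
      finally show ?thesis .
    qed
    then show "\<exists>N. \<forall>n\<ge>N. k \<le> card (C \<inter> {0..<n})"
      by blast
  qed
qed

text \<open>Each use of \<open>char_sum_step\<close> gains a factor \<rho>, because
  \<open>card D\<close> is absorbed by \<open>card_mult_div\<close>. The constant \<open>K\<close>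
  may grow with \<open>k\<close>, but it is uniform in \<open>N\<close> and over \<Theta>, as the
  step moves from \<open>(x, y)\<close> to \<open>(g x, y)\<close>.\<close>

lemma char_sum_bound:
  fixes \<Theta> :: "(real \<times> real) set" and \<rho> :: real
  assumes \<rho>: "0 \<le> \<rho>"
    and closed: "\<And>x y. (x, y) \<in> \<Theta> \<Longrightarrow> (real g * x, y) \<in> \<Theta>"
    and contr: "\<And>x y. (x, y) \<in> \<Theta> \<Longrightarrow> norm (\<Sum>d\<in>D. unit_exp ((x + y) * real d)) \<le> \<rho> * card D"
  shows "\<exists>K::real. \<forall>(x, y)\<in>\<Theta>. \<forall>N. norm (char_sum x y N) \<le> \<rho> ^ k * card (C \<inter> {0..<N}) + K"
proof (induction k)
  case 0
  have "norm (char_sum x y N) \<le> (\<Sum>n\<in>C \<inter> {0..<N}. 1)" for x y N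
    unfolding char_sum_def by (intro sum_norm_le) simp
  then show ?case
    by (intro exI[of _ 0]) auto
next
  case (Suc k)
  then obtain K :: real where K: "\<And>x y N. (x, y) \<in> \<Theta> \<Longrightarrow>
      norm (char_sum x y N) \<le> \<rho> ^ k * card (C \<inter> {0..<N}) + K"
    by blast
  have "norm (char_sum x y N) \<le> \<rho> ^ Suc k * card (C \<inter> {0..<N}) + (\<rho> * card D * K + 2 * g)"
    if xy: "(x, y) \<in> \<Theta>" for x y N
  proof -
    define A where "A = card (C \<inter> {0..<N div g})"
    have "norm (char_sum x y N) \<le> norm (\<Sum>d\<in>D. unit_exp ((x + y) * real d))
        * norm (char_sum (real g * x) y (N div g)) + 2 * g"
      by (rule char_sum_step)
    also have "\<dots> \<le> \<rho> * card D * (\<rho> ^ k * A + K) + 2 * g"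
      unfolding A_def using contr[OF xy] K[OF closed[OF xy]] \<rho>
      by (intro add_right_mono mult_mono) auto
    also have "\<dots> = \<rho> ^ Suc k * (card D * A) + (\<rho> * card D * K + 2 * g)"
      by (simp add: algebra_simps)
    also have "\<dots> \<le> \<rho> ^ Suc k * card (C \<inter> {0..<N}) + (\<rho> * card D * K + 2 * g)"
      unfolding A_def using of_nat_mono[OF card_mult_div[of N], where 'a = real] \<rho>
      by (intro add_right_mono mult_left_mono) auto
    finally show ?thesis .
  qed
  then show ?case
    by blast
qed

text \<open>First \<open>k\<close> is fixed so that \<open>\<rho> ^ k\<close> is small, then
  \<open>N\<close> is taken so large that the count outweighs the constant belonging to this
  \<open>k\<close>.\<close>

lemma char_sum_tendsto_0:
  fixes \<Theta> :: "(real \<times> real) set" and \<rho> :: real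
  assumes \<rho>: "0 \<le> \<rho>" "\<rho> < 1"
    and closed: "\<And>x y. (x, y) \<in> \<Theta> \<Longrightarrow> (real g * x, y) \<in> \<Theta>"
    and contr: "\<And>x y. (x, y) \<in> \<Theta> \<Longrightarrow> norm (\<Sum>d\<in>D. unit_exp ((x + y) * real d)) \<le> \<rho> * card D"
    and xy: "(x, y) \<in> \<Theta>"
  shows "(\<lambda>N. char_sum x y N / card (C \<inter> {0..<N})) \<longlonglongrightarrow> 0"
proof (rule tendstoI)
  fix \<epsilon> :: real assume \<epsilon>: "\<epsilon> > 0"
  obtain k where k: "\<rho> ^ k < \<epsilon> / 2"
    using real_arch_pow_inv[of "\<epsilon> / 2" \<rho>] \<rho> \<epsilon> by auto
  obtain K :: real where K: "\<And>N. norm (char_sum x y N) \<le> \<rho> ^ k * card (C \<inter> {0..<N}) + K"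
    using char_sum_bound[where \<Theta> = \<Theta> and \<rho> = \<rho> and k = k] \<rho> closed contr xy by blast
  \<comment> \<open>The bound 0 in the maximum keeps the denominator positive.\<close>
  have "eventually (\<lambda>N. real (card (C \<inter> {0..<N})) > max 0 (K / (\<epsilon> / 2))) sequentially"
    using filterlim_card_digit_restricted unfolding filterlim_at_top_dense by blast
  then show "eventually (\<lambda>N. dist (char_sum x y N / card (C \<inter> {0..<N})) 0 < \<epsilon>) sequentially"
  proof eventually_elim
    case (elim N)
    define A where "A = real (card (C \<inter> {0..<N}))"
    have A: "A > 0" "K < \<epsilon> / 2 * A"
      using elim \<epsilon> by (auto simp: A_def field_simps)
    have "norm (char_sum x y N) \<le> \<rho> ^ k * A + K"
      using K by (simp add: A_def)
    also have "\<dots> < \<epsilon> / 2 * A + \<epsilon> / 2 * A"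
      using A k by (intro add_strict_mono mult_strict_right_mono) auto
    finally show ?case
      using A by (simp add: norm_divide divide_less_eq A_def)
  qed
qed

end

section \<open>Densities of the residue classes\<close>

text \<open>This counts the characters of the integers mod \<open>a\<close> that are trivial on the
  subgroup generated by \<open>s\<close>: they are the multiples of \<open>a / s\<close>.\<close>

lemma card_dvd_mult:
  fixes a s :: nat
  assumes "a > 0" "s dvd a"
  shows "card {h. h < a \<and> a dvd h * s} = s"
proof -
  obtain q where q: "a = s * q"
    using assms by (elim dvdE)
  have "s > 0" "q > 0"
    using assms(1) q by auto
  have dvd: "a dvd h * s \<longleftrightarrow> q dvd h" for h
    using \<open>s > 0\<close> by (simp add: q mult.commute[of s])
  have less: "q * j < a \<longleftrightarrow> j < s" for j
    using \<open>q > 0\<close> by (simp add: q mult.commute[of s])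
  have "{h. h < a \<and> a dvd h * s} = (\<lambda>j. q * j) ` {..<s}"
    by (auto simp: dvd less elim!: dvdE)
  moreover have "inj_on (\<lambda>j. q * j) {..<s}"
    using \<open>q > 0\<close> by (auto simp: inj_on_def)
  ultimately show ?thesis
    by (simp add: card_image)
qed

context digit_set
begin

text \<open>Fourier inversion: each of the two congruences is detected by
  \<open>sum_unit_exp\<close>, and the sums are then interchanged.\<close>

lemma card_joint_class:
  fixes b b' :: int
  assumes "a > 0" "a' > 0"
  shows "of_nat (card (joint_class g C a a' b b' \<inter> {0..<N}))
    = (\<Sum>h<a. \<Sum>h'<a'. unit_exp (- (real h / real a * b + real h' / real a' * b'))
        * char_sum (real h / real a) (real h' / real a') N) / (of_nat a * of_nat a')"
proof -
  define X where "X = C \<inter> {0..<N}"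
  define p where "p n \<longleftrightarrow> int a dvd int n - b" for n
  define p' where "p' n \<longleftrightarrow> int a' dvd int (digit_sum g n) - b'" for n
  have "joint_class g C a a' b b' \<inter> {0..<N} = {n \<in> X. p n \<and> p' n}"
    by (auto simp: joint_class_def X_def p_def p'_def cong_iff_dvd_diff)
  then have "of_nat (card (joint_class g C a a' b b' \<inter> {0..<N})) * (of_nat a * of_nat a')
      = (\<Sum>n\<in>{n \<in> X. p n \<and> p' n}. of_nat a * of_nat a' :: complex)"
    by simp
  also have "\<dots> = (\<Sum>n\<in>X. if p n \<and> p' n then of_nat a * of_nat a' else 0)"
    by (rule sum.inter_filter) (simp add: X_def)
  also have "\<dots> = (\<Sum>n\<in>X. (if p n then of_nat a else 0) * (if p' n then of_nat a' else (0::complex)))"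
    by (rule sum.cong) auto
  also have "\<dots> = (\<Sum>n\<in>X. \<Sum>h<a. \<Sum>h'<a'.
      unit_exp (- (real h / real a * b + real h' / real a' * b'))
      * unit_exp (real h / real a * real n + real h' / real a' * real (digit_sum g n)))"
  proof (rule sum.cong[OF refl])
    fix n
    have "(if p n then of_nat a else 0) * (if p' n then of_nat a' else (0::complex))
      = (\<Sum>h<a. unit_exp (real h * (real_of_int (int n - b) / real a)))
      * (\<Sum>h'<a'. unit_exp (real h' * (real_of_int (int (digit_sum g n) - b') / real a')))"
      using assms by (simp only: sum_unit_exp p_def p'_def)
    also have "\<dots> = (\<Sum>h<a. \<Sum>h'<a'.
      unit_exp (- (real h / real a * b + real h' / real a' * b'))
      * unit_exp (real h / real a * real n + real h' / real a' * real (digit_sum g n)))"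
      unfolding sum_product unit_exp_add[symmetric]
      using assms by (intro sum.cong refl arg_cong[of _ _ unit_exp]) (simp add: field_simps)
    finally show "(if p n then of_nat a else 0) * (if p' n then of_nat a' else (0::complex)) = \<dots>" .
  qed
  also have "\<dots> = (\<Sum>h<a. \<Sum>h'<a'. unit_exp (- (real h / real a * b + real h' / real a' * b'))
        * char_sum (real h / real a) (real h' / real a') N)"
    unfolding char_sum_def sum_distrib_left X_def
    by (rule trans[OF sum.swap]) (intro sum.cong refl sum.swap)
  finally show ?thesis
    using assms by (simp add: field_simps)
qed

lemma dvd_digit_restricted:
  assumes "\<And>d. d \<in> D \<Longrightarrow> s dvd d" "n \<in> C"
  shows "s dvd n" "s dvd digit_sum g n"
proof -
  have "s dvd n \<and> s dvd digit_sum g n"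
    using assms(2)
  proof (induction rule: digit_restricted_induct)
    case (digit d)
    then show ?case
      using assms(1) digits digit_sum_digit[OF base] by auto
  next
    case (snoc m d)
    then show ?case
      using assms(1) digits digit_sum_snoc[OF base, of d m] by auto
  qed
  then show "s dvd n" "s dvd digit_sum g n"
    by auto
qed

text \<open>The assumption \<open>gen\<close> says that a character mod \<open>a * a'\<close>
  constant on the digits is trivial on multiples of \<open>s * s'\<close>. So a character nontrivial
  on the subgroup generated by \<open>s\<close> and \<open>s'\<close> is not constant on the digits,
  and the digit sum contracts.\<close>

lemma character_tendsto_0:
  assumes pos: "a > 0" "a' > 0" and coprime: "coprime g a" "coprime a a'"
    and s: "s dvd a" "s' dvd a'"
    and gen: "\<And>u. \<forall>d\<in>D. \<forall>e\<in>D. [u * d = u * e] (mod (a * a')) \<Longrightarrow> a * a' dvd u * (s * s')"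
    and nontrivial: "\<not> (a dvd h * s \<and> a' dvd h' * s')"
  shows "(\<lambda>N. char_sum (real h / real a) (real h' / real a') N / card (C \<inter> {0..<N})) \<longlonglongrightarrow> 0"
proof -
  define \<Theta> where "\<Theta> = {(real h / real a, real h' / real a') | h h'. \<not> (a dvd h * s \<and> a' dvd h' * s')}"
  have "a * a' > 0"
    using pos by simp
  from character_sum_contraction[OF this finite_digits]
  obtain \<rho> :: real where \<rho>: "0 \<le> \<rho>" "\<rho> < 1"
    and contr: "\<And>u. \<exists>d\<in>D. \<exists>e\<in>D. \<not> [u * d = u * e] (mod (a * a')) \<Longrightarrow>
      norm (\<Sum>d\<in>D. unit_exp (real (u * d) / real (a * a'))) \<le> \<rho> * card D"
    by metis
  show ?thesis
  proof (rule char_sum_tendsto_0[OF \<rho>, where \<Theta> = \<Theta>])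
    show "(real h / real a, real h' / real a') \<in> \<Theta>"
      using nontrivial by (auto simp: \<Theta>_def)
  next
    fix x y assume "(x, y) \<in> \<Theta>"
    then obtain h h' where xy: "x = real h / real a" "y = real h' / real a'"
      and hh': "\<not> (a dvd h * s \<and> a' dvd h' * s')"
      by (auto simp: \<Theta>_def)
    \<comment> \<open>Multiplication by \<open>g\<close> is invertible mod \<open>a\<close>, so it
      preserves nontriviality.\<close>
    have "coprime a g"
      using coprime by (simp add: coprime_commute)
    then have "\<not> (a dvd (g * h) * s \<and> a' dvd h' * s')"
      using hh' by (simp add: mult.assoc coprime_dvd_mult_right_iff)
    moreover have "real g * x = real (g * h) / real a"
      by (simp add: xy)
    ultimately show "(real g * x, y) \<in> \<Theta>"
      unfolding \<Theta>_def xy(2) by blast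
    \<comment> \<open>Chosen so that \<open>x + y = u / (a a')\<close>: the two characters merge
      into one with modulus \<open>a * a'\<close>, and coprimality separates them again
      below.\<close>
    define u where "u = h * a' + h' * a"
    have "\<exists>d\<in>D. \<exists>e\<in>D. \<not> [u * d = u * e] (mod (a * a'))"
    proof (rule ccontr)
      assume "\<not> (\<exists>d\<in>D. \<exists>e\<in>D. \<not> [u * d = u * e] (mod (a * a')))"
      then have "a * a' dvd u * (s * s')"
        using gen by blast
      then have dvd: "a dvd u * (s * s')" "a' dvd u * (s * s')"
        using dvd_mult_left dvd_mult_right by blast+
      have cop: "coprime a a'" "coprime a s'" "coprime a' a" "coprime a' s"
        using coprime s coprime_divisors[of a a s' a'] coprime_divisors[of s a a' a']
        by (simp_all add: coprime_commute)
      have eq: "u * (s * s') = a * (h' * s * s') + (h * s) * (a' * s')"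
        and eq': "u * (s * s') = a' * (h * s * s') + (h' * s') * (a * s)"
        by (simp_all add: u_def algebra_simps)
      have "a dvd (h * s) * (a' * s')"
        using dvd(1) unfolding eq by (simp only: dvd_add_right_iff[OF dvd_triv_left])
      moreover have "a' dvd (h' * s') * (a * s)"
        using dvd(2) unfolding eq' by (simp only: dvd_add_right_iff[OF dvd_triv_left])
      ultimately have "a dvd h * s" "a' dvd h' * s'"
        using cop by (simp_all only: coprime_dvd_mult_left_iff coprime_mult_right_iff)
      with hh' show False
        by blast
    qed
    from contr[OF this] have "norm (\<Sum>d\<in>D. unit_exp (real (u * d) / real (a * a'))) \<le> \<rho> * card D" .
    also have "(\<Sum>d\<in>D. unit_exp (real (u * d) / real (a * a')))
        = (\<Sum>d\<in>D. unit_exp ((x + y) * real d))"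
      using pos by (intro sum.cong refl arg_cong[of _ _ unit_exp])
        (simp add: xy u_def field_simps)
    finally show "norm (\<Sum>d\<in>D. unit_exp ((x + y) * real d)) \<le> \<rho> * card D" .
  qed
qed

text \<open>In the Fourier expansion a character trivial on the subgroup equals 1 on all of
  \<open>C\<close> and at \<open>(b, b')\<close>, so it contributes exactly 1 once the count is
  positive. The others contribute 0 in the limit, and there are \<open>s * s'\<close> trivial
  ones.\<close>

lemma joint_ratio_tendsto:
  fixes b b' :: int
  assumes pos: "a > 0" "a' > 0" and coprime: "coprime g a" "coprime a a'"
    and s: "s dvd a" "s' dvd a'"
    and dvd_digits: "\<And>d. d \<in> D \<Longrightarrow> s dvd d" "\<And>d. d \<in> D \<Longrightarrow> s' dvd d"
    and gen: "\<And>u. \<forall>d\<in>D. \<forall>e\<in>D. [u * d = u * e] (mod (a * a')) \<Longrightarrow> a * a' dvd u * (s * s')"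
    and b: "int s dvd b" "int s' dvd b'"
  shows "joint_ratio g C a a' b b' \<longlonglongrightarrow> real (s * s') / (real a * real a')"
proof -
  define A where "A N = card (C \<inter> {0..<N})" for N
  define T where "T h h' \<longleftrightarrow> a dvd h * s \<and> a' dvd h' * s'" for h h'
  define f where "f h h' N = unit_exp (- (real h / real a * b + real h' / real a' * b'))
        * (char_sum (real h / real a) (real h' / real a') N / of_nat (A N))" for h h' N
  have int_quot: "real h / real a * real_of_int k \<in> \<int>"
    if "a > 0" "a dvd h * s" "int s dvd k" for a h s :: nat and k
  proof -
    have "int a dvd int h * int s"
      using that by (metis of_nat_dvd_iff of_nat_mult)
    also have "\<dots> dvd int h * k"
      using that by simp
    finally have "real_of_int (int h * k) / real a \<in> \<int>"
      using that by (simp only: of_int_divide_in_Ints_iff)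
    then show ?thesis
      by simp
  qed
  have lim: "(\<lambda>N. f h h' N) \<longlonglongrightarrow> (if T h h' then 1 else 0)" for h h'
  proof (cases "T h h'")
    case True
    have one: "unit_exp (- (real h / real a * b + real h' / real a' * b')) = 1"
      unfolding unit_exp_eq_1_iff
      using True int_quot[OF pos(1) _ b(1)] int_quot[OF pos(2) _ b(2)]
      by (intro minus_in_Ints_iff[THEN iffD2] Ints_add) (auto simp: T_def)
    have "char_sum (real h / real a) (real h' / real a') N = of_nat (A N)" for N
    proof -
      have "unit_exp (real h / real a * real n + real h' / real a' * real (digit_sum g n)) = 1"
        if "n \<in> C" for n
        unfolding unit_exp_eq_1_iff
        using int_quot[OF pos(1), of h s "int n"] int_quot[OF pos(2), of h' s' "int (digit_sum g n)"] True
          dvd_digit_restricted(1)[OF dvd_digits(1) that] dvd_digit_restricted(2)[OF dvd_digits(2) that]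
        by (intro Ints_add) (simp_all add: T_def)
      then show ?thesis
        by (simp add: char_sum_def A_def)
    qed
    \<comment> \<open>Where the count is 0 the quotient has the default value 0, so it equals 1 only
      eventually.\<close>
    moreover have "eventually (\<lambda>N. A N \<noteq> 0) sequentially"
    proof -
      have "eventually (\<lambda>N. real (A N) > 0) sequentially"
        using filterlim_card_digit_restricted unfolding filterlim_at_top_dense A_def by blast
      then show ?thesis
        by eventually_elim simp
    qed
    ultimately have "eventually (\<lambda>N. f h h' N = 1) sequentially"
      unfolding f_def one by (auto elim!: eventually_mono)
    then show ?thesis
      using True by (simp add: tendsto_eventually)
  next
    case False
    then have "(\<lambda>N. char_sum (real h / real a) (real h' / real a') N / of_nat (A N)) \<longlonglongrightarrow> 0"
      unfolding A_def T_def using character_tendsto_0[OF pos coprime s gen] by simp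
    then have "f h h' \<longlonglongrightarrow> 0"
      unfolding f_def by (rule tendsto_mult_right_zero)
    then show ?thesis
      using False by simp
  qed
  have ratio: "complex_of_real (joint_ratio g C a a' b b' N)
      = (\<Sum>h<a. \<Sum>h'<a'. f h h' N) / (of_nat a * of_nat a')" for N
    unfolding joint_ratio_def f_def using card_joint_class[OF pos, of b b' N]
    by (simp add: A_def sum_divide_distrib mult_ac)
  have "(\<lambda>N. complex_of_real (joint_ratio g C a a' b b' N))
      \<longlonglongrightarrow> (\<Sum>h<a. \<Sum>h'<a'. if T h h' then 1 else 0) / (of_nat a * of_nat a')"
    unfolding ratio by (intro tendsto_intros lim) (use pos in auto)
  also have "(\<Sum>h<a. \<Sum>h'<a'. if T h h' then 1 else 0) = (of_nat (s * s') :: complex)"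
  proof -
    have "(\<Sum>h<a. \<Sum>h'<a'. if T h h' then 1 else 0)
       = (\<Sum>h<a. if a dvd h * s then 1 else 0) * (\<Sum>h'<a'. if a' dvd h' * s' then 1 else (0::complex))"
      unfolding sum_product T_def by (intro sum.cong refl) auto
    also have "\<dots> = of_nat (card {h. h < a \<and> a dvd h * s} * card {h'. h' < a' \<and> a' dvd h' * s'})"
      by (simp add: sum.If_cases Int_def)
    finally show ?thesis
      using pos s by (simp only: card_dvd_mult)
  qed
  also have "of_nat (s * s') / (of_nat a * of_nat a')
      = complex_of_real (real (s * s') / (real a * real a'))"
    by simp
  finally show ?thesis
    by (simp only: tendsto_of_real_iff)
qed

lemma joint_class_empty:
  fixes b b' :: int
  assumes s: "s dvd a" "s' dvd a'"
    and dvd_digits: "\<And>d. d \<in> D \<Longrightarrow> s dvd d" "\<And>d. d \<in> D \<Longrightarrow> s' dvd d"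
    and b: "\<not> (int s dvd b \<and> int s' dvd b')"
  shows "joint_class g C a a' b b' = {}"
proof -
  have "int s dvd b \<and> int s' dvd b'" if n: "n \<in> joint_class g C a a' b b'" for n
  proof -
    have "n \<in> C" "[int n = b] (mod int a)" "[int (digit_sum g n) = b'] (mod int a')"
      using n by (auto simp: joint_class_def)
    moreover from this have "[int n = b] (mod int s)" "[int (digit_sum g n) = b'] (mod int s')"
      using s by (auto intro: cong_dvd_modulus)
    ultimately show ?thesis
      using dvd_digit_restricted(1)[OF dvd_digits(1)] dvd_digit_restricted(2)[OF dvd_digits(2)]
        cong_dvd_iff by (metis of_nat_dvd_iff)
  qed
  then show ?thesis
    using b by blast
qed

end

section \<open>Oscillation of the densities\<close>

context digit_set
begin

text \<open>Without the digit 0 the leading digit is nonzero, so the size of \<open>n\<close>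
  reveals its length \<open>m + 1\<close>; all digits being congruent to \<open>c\<close>, the
  length determines both residues.\<close>

lemma digit_restricted_length:
  assumes nz: "0 \<notin> D"
    and c: "\<And>d. d \<in> D \<Longrightarrow> [d = c] (mod s)" "\<And>d. d \<in> D \<Longrightarrow> [d = c] (mod s')"
    and "n \<in> C"
  shows "\<exists>m. g ^ m \<le> n \<and> n < g ^ Suc m \<and> [n = c * (\<Sum>i\<le>m. g ^ i)] (mod s)
           \<and> [digit_sum g n = c * Suc m] (mod s')"
  using assms(4)
proof (induction rule: digit_restricted_induct)
  case (digit d)
  then have "d < g" "d > 0"
    using digits nz by (auto intro: gr0I)
  then show ?case
    using digit c digit_sum_digit[OF base, of d] by (intro exI[of _ 0]) auto
next
  case (snoc n d)
  then obtain m where m: "g ^ m \<le> n" "n < g ^ Suc m"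
    "[n = c * (\<Sum>i\<le>m. g ^ i)] (mod s)" "[digit_sum g n = c * Suc m] (mod s')"
    by blast
  have d: "d < g"
    using snoc digits by auto
  have "g ^ Suc m \<le> g * n + d"
    using m(1) by (simp add: trans_le_add1)
  moreover have "g * n + d < g ^ Suc (Suc m)"
  proof -
    have "g * n + d < g * Suc n"
      using d by simp
    also have "\<dots> \<le> g * g ^ Suc m"
      using m(2) by (intro mult_le_mono2) simp
    finally show ?thesis
      by simp
  qed
  moreover have "[g * n + d = c * (\<Sum>i\<le>Suc m. g ^ i)] (mod s)"
  proof -
    have "[g * n + d = g * (c * (\<Sum>i\<le>m. g ^ i)) + c] (mod s)"
      by (intro cong_add cong_scalar_left m c snoc)
    also have "g * (c * (\<Sum>i\<le>m. g ^ i)) + c = c * (\<Sum>i\<le>Suc m. g ^ i)"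
      unfolding sum.atMost_Suc_shift by (simp add: sum_distrib_left algebra_simps)
    finally show ?thesis .
  qed
  moreover have "[digit_sum g (g * n + d) = c * Suc (Suc m)] (mod s')"
    using cong_add[OF m(4) c(2)[OF snoc(2)]] digit_sum_snoc[OF base d, of n]
    by (simp add: algebra_simps)
  ultimately show ?case
    by blast
qed

text \<open>If both blocks met the class, comparing the residues for the two lengths would give
  \<open>s dvd c * g ^ Suc m\<close> and \<open>s' dvd c\<close>, and \<open>g\<close> is invertible
  mod \<open>s\<close>.\<close>

lemma joint_class_gap:
  fixes b b' :: int
  assumes nz: "0 \<notin> D"
    and s: "s dvd a" "s' dvd a'" and coprime: "coprime g s"
    and c: "\<And>d. d \<in> D \<Longrightarrow> [d = c] (mod s)" "\<And>d. d \<in> D \<Longrightarrow> [d = c] (mod s')"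
    and nontrivial: "\<not> (s dvd c \<and> s' dvd c)"
  shows "joint_class g C a a' b b' \<inter> {g ^ m..<g ^ Suc m} = {}
       \<or> joint_class g C a a' b b' \<inter> {g ^ Suc m..<g ^ Suc (Suc m)} = {}"
proof -
  have *: "[int (c * (\<Sum>i\<le>m. g ^ i)) = b] (mod int s) \<and> [int (c * Suc m) = b'] (mod int s')"
    if n: "n \<in> joint_class g C a a' b b'" "n \<in> {g ^ m..<g ^ Suc m}" for n m
  proof -
    have "n \<in> C"
      using n by (simp add: joint_class_def)
    with digit_restricted_length[OF nz c, of n] obtain k where k: "g ^ k \<le> n" "n < g ^ Suc k"
      "[n = c * (\<Sum>i\<le>k. g ^ i)] (mod s)" "[digit_sum g n = c * Suc k] (mod s')"
      by blast
    have "g ^ k < g ^ Suc m" "g ^ m < g ^ Suc k"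
      using k n by auto
    \<comment> \<open>Two blocks between consecutive powers of \<open>g\<close> that share
      \<open>n\<close> coincide.\<close>
    then have "k = m"
      using base by (metis Suc_leI le_antisym less_Suc_eq_le nat_power_less_imp_less
          not_gr0 not_numeral_le_zero)
    moreover have "[int n = b] (mod int s)" "[int (digit_sum g n) = b'] (mod int s')"
      using n s by (auto simp: joint_class_def intro: cong_dvd_modulus)
    ultimately show ?thesis
      using k by (meson cong_int_iff cong_sym cong_trans)
  qed
  show ?thesis
  proof (rule ccontr)
    assume "\<not> ?thesis"
    then obtain n n' where n: "n \<in> joint_class g C a a' b b'" "n \<in> {g ^ m..<g ^ Suc m}"
      and n': "n' \<in> joint_class g C a a' b b'" "n' \<in> {g ^ Suc m..<g ^ Suc (Suc m)}"
      by blast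
    have "[c * (\<Sum>i\<le>Suc m. g ^ i) = c * (\<Sum>i\<le>m. g ^ i)] (mod s)"
      and 1: "[c * Suc (Suc m) = c * Suc m] (mod s')"
      using *[OF n] *[OF n'] by (meson cong_int_iff cong_sym cong_trans)+
    then have "[c * (\<Sum>i\<le>m. g ^ i) + c * g ^ Suc m = c * (\<Sum>i\<le>m. g ^ i) + 0] (mod s)"
      "[c * Suc m + c = c * Suc m + 0] (mod s')"
      by (simp_all add: distrib_left add_ac)
    then have "s dvd c * g ^ Suc m" "s' dvd c"
      unfolding cong_add_lcancel_nat by (simp_all add: cong_0_iff)
    moreover have "coprime s (g ^ Suc m)"
      using coprime by (simp add: coprime_commute)
    ultimately show False
      using nontrivial coprime_dvd_mult_left_iff by blast
  qed
qed

text \<open>Across an empty block the numerator is unchanged, while the denominator at least doubles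
  because there are two digits or more.\<close>

lemma joint_ratio_halved:
  fixes b b' :: int
  assumes "joint_class g C a a' b b' \<inter> {g ^ m..<g ^ Suc m} = {}"
  shows "joint_ratio g C a a' b b' (g ^ Suc m) \<le> joint_ratio g C a a' b b' (g ^ m) / 2"
proof -
  define J where "J = joint_class g C a a' b b'"
  define A where "A N = card (C \<inter> {0..<N})" for N
  have "g ^ m \<le> g ^ Suc m"
    using base by simp
  then have "{0..<g ^ Suc m} = {0..<g ^ m} \<union> {g ^ m..<g ^ Suc m}"
    by (simp only: ivl_disj_un_two(3) zero_le)
  then have J: "J \<inter> {0..<g ^ Suc m} = J \<inter> {0..<g ^ m}"
    using assms by (auto simp: J_def)
  have "2 * A (g ^ m) \<le> card D * A (g ^ m)"
    using two_digits by simp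
  also have "\<dots> \<le> A (g ^ Suc m)"
    unfolding A_def using card_mult_div[of "g ^ Suc m"] base by simp
  finally have A: "2 * real (A (g ^ m)) \<le> real (A (g ^ Suc m))"
    by linarith
  show ?thesis
  proof (cases "A (g ^ m) = 0")
    \<comment> \<open>With no elements of \<open>C\<close> below \<open>g ^ m\<close>, both
      numerators are 0 and so are both ratios.\<close>
    case True
    have "J \<inter> {0..<g ^ m} \<subseteq> C \<inter> {0..<g ^ m}"
      by (auto simp: J_def joint_class_def)
    then have "J \<inter> {0..<g ^ m} = {}"
      using True by (auto simp: A_def)
    then show ?thesis
      using J by (simp add: joint_ratio_def flip: J_def)
  next
    case False
    then have "real (card (J \<inter> {0..<g ^ m})) / real (A (g ^ Suc m))
        \<le> real (card (J \<inter> {0..<g ^ m})) / (2 * real (A (g ^ m)))"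
      using A by (intro divide_left_mono) auto
    then show ?thesis
      using J by (simp add: joint_ratio_def A_def mult.commute flip: J_def)
  qed
qed

text \<open>Of any two consecutive blocks one is empty, so halving occurs arbitrarily far out and a
  positive limit is impossible.\<close>

lemma joint_ratio_limit_eq_0:
  fixes b b' :: int
  assumes nz: "0 \<notin> D"
    and s: "s dvd a" "s' dvd a'" and coprime: "coprime g s"
    and c: "\<And>d. d \<in> D \<Longrightarrow> [d = c] (mod s)" "\<And>d. d \<in> D \<Longrightarrow> [d = c] (mod s')"
    and nontrivial: "\<not> (s dvd c \<and> s' dvd c)"
    and L: "joint_ratio g C a a' b b' \<longlonglongrightarrow> L"
  shows "L = 0"
proof (rule ccontr)
  assume "L \<noteq> 0"
  define r where "r m = joint_ratio g C a a' b b' (g ^ m)" for m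
  have "0 \<le> L"
    using L by (rule LIMSEQ_le_const) (auto simp: joint_ratio_def)
  with \<open>L \<noteq> 0\<close> have "L > 0"
    by simp
  have "strict_mono (\<lambda>m. g ^ m)"
    using base by (auto intro: strict_monoI power_strict_increasing)
  from LIMSEQ_subseq_LIMSEQ[OF L this] have "r \<longlonglongrightarrow> L"
    unfolding r_def o_def .
  \<comment> \<open>With \<open>L / 4\<close>, halving yields \<open>r (Suc m) < 5 L / 8\<close>,
    whereas closeness to \<open>L\<close> requires more than \<open>3 L / 4\<close>.\<close>
  then obtain M where M: "\<And>m. m \<ge> M \<Longrightarrow> norm (r m - L) < L / 4"
    using LIMSEQ_D[of r L "L / 4"] \<open>L > 0\<close> by auto
  obtain m where "m \<ge> M" "joint_class g C a a' b b' \<inter> {g ^ m..<g ^ Suc m} = {}"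
    using joint_class_gap[OF nz s coprime c nontrivial, of b b' M] by (metis le_refl le_SucI)
  then have "r (Suc m) \<le> r m / 2"
    unfolding r_def by (intro joint_ratio_halved)
  moreover have "\<bar>r m - L\<bar> < L / 4" "\<bar>r (Suc m) - L\<bar> < L / 4"
    using M[of m] M[of "Suc m"] \<open>m \<ge> M\<close> by auto
  ultimately show False
    using \<open>L > 0\<close> by linarith
qed

end

section \<open>Residue subgroups and assembly of the three claims\<close>

lemma residue_subgroup_iff:
  assumes "s dvd a" "b \<in> carrier (integer_mod_group a)"
  shows "b \<in> residue_subgroup a s \<longleftrightarrow> int s dvd b"
proof -
  interpret group "integer_mod_group a"
    by simp
  have "int s mod int a \<in> carrier (integer_mod_group a)"
    by (simp add: carrier_integer_mod_group)
  then have "residue_subgroup a s = {k * (int s mod int a) mod int a | k :: int. k \<in> UNIV}"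
    unfolding residue_subgroup_def by (simp only: generate_pow int_pow_integer_mod_group)
  then have "b \<in> residue_subgroup a s \<longleftrightarrow> (\<exists>k. b = k * int s mod int a)"
    by (auto simp: mod_mult_right_eq)
  \<comment> \<open>As \<open>s\<close> divides \<open>a\<close>, reduction mod \<open>a\<close>
    does not affect divisibility by \<open>s\<close>.\<close>
  also have "\<dots> \<longleftrightarrow> int s dvd b"
  proof
    assume "\<exists>k. b = k * int s mod int a"
    then show "int s dvd b"
      using assms(1) by (auto simp: dvd_mod_iff)
  next
    assume "int s dvd b"
    then obtain k where "b = k * int s"
      by (metis dvdE mult.commute)
    moreover have "b mod int a = b"
      using assms(2) by (auto simp: carrier_integer_mod_group split: if_splits)
    ultimately show "\<exists>k. b = k * int s mod int a"
      by metis
  qed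
  finally show ?thesis .
qed

theorem theorem5p4:
  fixes g t a a' \<delta> \<delta>\<^sub>a \<delta>\<^sub>a' :: nat
    and d :: "nat \<Rightarrow> nat"
    and D :: "nat set"
  assumes g: "g \<ge> 2"
    and t: "t \<ge> 2"
    and D: "D = d ` {1..t}"
    and distinct_digits: "inj_on d {1..t}"
    and digits: "D \<subseteq> {0..g - 1}"
    and smallest: "\<forall>i\<in>{1..t}. d 1 \<le> d i"
    and pos: "a \<ge> 1" "a' \<ge> 1"
    and coprime: "gcd g a = 1" "gcd a a' = 1"
    and \<delta>: "\<delta> = Gcd (insert (a * a') ((\<lambda>i. d i - d 1) ` {2..t}))"
    and \<delta>\<^sub>a: "\<delta>\<^sub>a = gcd \<delta> a"
    and \<delta>\<^sub>a': "\<delta>\<^sub>a' = gcd \<delta> a'"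
  shows
    "(jointly_uniformly_distributed g (digit_restricted g D) a a' \<longleftrightarrow> \<delta> = 1)
     \<and> ([d 1 = 0] (mod \<delta>\<^sub>a) \<and> [d 1 = 0] (mod \<delta>\<^sub>a') \<longrightarrow>
         (\<forall>(b, b') \<in> carrier (integer_mod_group a) \<times> carrier (integer_mod_group a').
            ((b, b') \<in> residue_subgroup a \<delta>\<^sub>a \<times> residue_subgroup a' \<delta>\<^sub>a' \<longrightarrow>
               joint_ratio g (digit_restricted g D) a a' b b'
                 \<longlonglongrightarrow> real \<delta> / (real a * real a')) \<and>
            ((b, b') \<notin> residue_subgroup a \<delta>\<^sub>a \<times> residue_subgroup a' \<delta>\<^sub>a' \<longrightarrow>
               joint_class g (digit_restricted g D) a a' b b' = {})))
     \<and> (\<not> ([d 1 = 0] (mod \<delta>\<^sub>a) \<and> [d 1 = 0] (mod \<delta>\<^sub>a')) \<longrightarrow>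
         (\<forall>(b, b') \<in> carrier (integer_mod_group a) \<times> carrier (integer_mod_group a').
            joint_ratio g (digit_restricted g D) a a' b b' \<longlonglongrightarrow> 0 \<or>
            \<not> convergent (joint_ratio g (digit_restricted g D) a a' b b')))"
    (is "?jud \<and> (?div \<longrightarrow> ?part2) \<and> (\<not> ?div \<longrightarrow> ?part3)")
proof -
  have "card D = t"
    using D distinct_digits by (simp add: card_image)
  moreover have "D \<subseteq> {..<g}"
    using digits g by force
  ultimately interpret digit_set g D
    using g t by unfold_locales auto
  have apos: "a > 0" "a' > 0"
    using pos by auto
  have cop: "coprime g a" "coprime a a'"
    using coprime by (simp_all add: coprime_iff_gcd_eq_1)
  have s: "\<delta>\<^sub>a dvd a" "\<delta>\<^sub>a' dvd a'" "\<delta>\<^sub>a dvd \<delta>" "\<delta>\<^sub>a' dvd \<delta>"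
    by (simp_all add: \<delta>\<^sub>a \<delta>\<^sub>a')
  have \<delta>_dvd: "\<delta> dvd a * a'" "\<And>i. i \<in> {2..t} \<Longrightarrow> \<delta> dvd d i - d 1"
    unfolding \<delta> by (auto intro!: Gcd_dvd simp del: Gcd_insert)
  \<comment> \<open>A divisor of \<open>a * a'\<close> is a product of a divisor of \<open>a\<close>
    and one of \<open>a'\<close>; coprimality of the two gcds gives the converse
    divisibility.\<close>
  have \<delta>_eq: "\<delta> = \<delta>\<^sub>a * \<delta>\<^sub>a'"
  proof (rule dvd_antisym)
    obtain p q where "\<delta> = p * q" "p dvd a" "q dvd a'"
      using division_decomp[OF \<delta>_dvd(1)] by blast
    then show "\<delta> dvd \<delta>\<^sub>a * \<delta>\<^sub>a'"
      unfolding \<delta>\<^sub>a \<delta>\<^sub>a' by (metis dvd_triv_left dvd_triv_right gcd_greatest mult_dvd_mono)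
    have "coprime \<delta>\<^sub>a \<delta>\<^sub>a'"
      using cop(2) s by (metis coprime_divisors)
    with s show "\<delta>\<^sub>a * \<delta>\<^sub>a' dvd \<delta>"
      by (intro divides_mult)
  qed
  have cong: "[x = d 1] (mod m)" if "x \<in> D" "m dvd \<delta>" for x m
  proof -
    obtain i where i: "x = d i" "i \<in> {1..t}"
      using \<open>x \<in> D\<close> D by auto
    have "m dvd d i - d 1"
      using i \<delta>_dvd(2)[of i] that(2) by (cases "i = 1") (auto intro: dvd_trans)
    then show ?thesis
      using smallest i by (simp add: cong_altdef_nat)
  qed
  have gen: "a * a' dvd u * (\<delta>\<^sub>a * \<delta>\<^sub>a')"
    if u: "\<forall>x\<in>D. \<forall>y\<in>D. [u * x = u * y] (mod (a * a'))" for u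
  proof -
    have "a * a' dvd u * (d i - d 1)" if "i \<in> {2..t}" for i
    proof -
      have "d i \<in> D" "d 1 \<in> D" "d 1 \<le> d i"
        using that D smallest t by auto
      then have "[u * d i = u * d 1] (mod (a * a'))" "u * d 1 \<le> u * d i"
        using u by auto
      then show ?thesis
        by (simp add: cong_altdef_nat diff_mult_distrib2)
    qed
    \<comment> \<open>\<open>a * a'\<close> divides \<open>u\<close> times each generator of
      \<delta>, including \<open>a * a'\<close> itself, hence \<open>u\<close> times their
      gcd.\<close>
    then have "a * a' dvd Gcd ((*) u ` insert (a * a') ((\<lambda>i. d i - d 1) ` {2..t}))"
      by (intro Gcd_greatest) auto
    also have "\<dots> = u * \<delta>"
      unfolding \<delta> by (simp only: Gcd_mult normalize_nat_def id_apply)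
    finally show ?thesis
      by (simp only: \<delta>_eq)
  qed
  have div_iff: "?div \<longleftrightarrow> \<delta>\<^sub>a dvd d 1 \<and> \<delta>\<^sub>a' dvd d 1"
    by (simp add: cong_0_iff)
  have part2: ?part2 if ?div
  proof -
    have dvd: "\<delta>\<^sub>a dvd x" "\<delta>\<^sub>a' dvd x" if "x \<in> D" for x
      using \<open>?div\<close> cong[OF that s(3)] cong[OF that s(4)] unfolding div_iff
      by (auto simp: cong_dvd_iff)
    show ?thesis
      using joint_ratio_tendsto[OF apos cop s(1,2) dvd gen]
        joint_class_empty[OF s(1,2) dvd]
      by (auto simp: residue_subgroup_iff s \<delta>_eq simp del: of_nat_mult)
  qed
  have part3: ?part3 if "\<not> ?div"
  proof -
    have ndvd: "\<not> (\<delta>\<^sub>a dvd d 1 \<and> \<delta>\<^sub>a' dvd d 1)"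
      using that div_iff by blast
    \<comment> \<open>The smallest digit is nonzero, since 0 is divisible by everything; hence no
      digit is 0 and lengths can be read off.\<close>
    then have "d 1 \<noteq> 0"
      by (metis dvd_0_right)
    then have nz: "0 \<notin> D"
      using D smallest by fastforce
    have "coprime g \<delta>\<^sub>a"
      using cop(1) s(1) by (metis coprime_divisors dvd_refl)
    from joint_ratio_limit_eq_0[OF nz s(1,2) this cong[OF _ s(3)] cong[OF _ s(4)] ndvd]
    show ?thesis
      by (auto simp: convergent_def)
  qed
  have zero: "0 \<in> carrier (integer_mod_group a)" "0 \<in> carrier (integer_mod_group a')"
    using apos by (simp_all add: carrier_integer_mod_group)
  have ?jud
  proof
    assume jud: "jointly_uniformly_distributed g (digit_restricted g D) a a'"
    then have lim: "joint_ratio g C a a' 0 0 \<longlonglongrightarrow> 1 / (real a * real a')"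
      using zero by (simp add: jointly_uniformly_distributed_def)
    \<comment> \<open>The pair (0, 0) lies in every subgroup, so its limit alone determines
      \<delta>; without the divisibility that limit would have to be 0.\<close>
    have ?div
    proof (rule ccontr)
      assume "\<not> ?div"
      from part3[OF this] zero convergentI[OF lim] have "joint_ratio g C a a' 0 0 \<longlonglongrightarrow> 0"
        by blast
      from LIMSEQ_unique[OF lim this] show False
        using apos by simp
    qed
    from part2[OF this] zero have "joint_ratio g C a a' 0 0 \<longlonglongrightarrow> real \<delta> / (real a * real a')"
      by (auto simp: residue_subgroup_iff s)
    from LIMSEQ_unique[OF lim this] show "\<delta> = 1"
      using apos by simp
  next
    assume "\<delta> = 1"
    \<comment> \<open>Now both subgroups are the full residue groups, so the limits for subgroup
      elements cover every pair.\<close>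
    then have one: "\<delta>\<^sub>a = 1" "\<delta>\<^sub>a' = 1"
      by (simp_all add: \<delta>\<^sub>a \<delta>\<^sub>a')
    then have ?div
      by (simp add: cong_def)
    have "joint_ratio g C a a' b b' \<longlonglongrightarrow> 1 / (real a * real a')"
      if "b \<in> carrier (integer_mod_group a)" "b' \<in> carrier (integer_mod_group a')" for b b'
      using part2[OF \<open>?div\<close>] that \<open>\<delta> = 1\<close> by (auto simp: residue_subgroup_iff one)
    then show "jointly_uniformly_distributed g (digit_restricted g D) a a'"
      by (simp add: jointly_uniformly_distributed_def)
  qed
  with part2 part3 show ?thesis
    by blast
qed

end
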